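(* Let $\mathcal{U}$ be a finite subset of $\mathbb{N}=\{1,2,\dots\}$ with $1\in\mathcal{U}$, let $d:\mathcal{U}\to\mathbb{N}$ be a function (write $d_a=d(a)$), and let $\{\alpha_s(d)\}_{s\in\mathbb{N}}$ be its initial degree sequence, $\alpha_s=\alpha_s(d)$. (a) For any $s\in\mathcal{U}$, $d_s$ is a subadditive term of $d$ if and only if $\alpha_s=d_s$. (b) For any $s\in\mathcal{U}$, $d_s$ is a strictly subadditive term of $d$ if and only if $d_s<\sum_{i\in\mathcal{U}}b_id_i$ for all families of non-negative integers $\{b_i: i\in\mathcal{U}\}$ such that $\sum_{i\in\mathcal{U}}ib_i=s$ and $b_s=0$. (c) $\alpha_s(d)=\alpha_s(d|_{\mathcal{U}'})$ for all $s\in\mathbb{N}$, where $\mathcal{U}'=\{i\in\mathcal{U}: d_i \text{ is a strictly subadditive term of } d\}$. (d) $\lim_{s\to\infty}\frac{\alpha_s}{s}=\min_{i\in\mathcal{U}'}\left\{\frac{d_i}{i}\right\}$, with $\mathcal{U}'$ as in (c).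
   Context: For a finite set $\mathcal{U}\subset\mathbb{N}$ with $1\in\mathcal{U}$ and $d:\mathcal{U}\to\mathbb{N}$, the initial degree sequence of $d$ is \[\alpha_s(d)=\min\Big\{\sum_{i\in\mathcal{U}}d_ib_i : b_i\in\mathbb{Z}_{\ge0}\text{ for all } i\in\mathcal{U},\ \sum_{i\in\mathcal{U}}ib_i=s\Big\},\qquad s\in\mathbb{N}.\] For $s\in\mathcal{U}$, $d_s$ is a subadditive term of $d$ if for all $m\in\mathbb{N}$ and all (not necessarily distinct) $a_1,\dots,a_m\in\mathcal{U}$ with $\sum_{i=1}^m a_i=s$ one has $d_s\le\sum_{i=1}^m d_{a_i}$. For $s\in\mathcal{U}$, $d_s$ is a strictly subadditive term of $d$ if for all $m\ge2$ and all (not necessarily distinct) $a_1,\dots,a_m\in\mathcal{U}$ with $\sum_{i=1}^m a_i=s$ one has $d_s<\sum_{i=1}^m d_{a_i}$. The term $d_1$ is by convention always both subadditive and strictly subadditive. *)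

theory Defs
  imports Complex_Main
begin

text \<open>
  A function \<open>d\<close> on a finite set \<open>U\<close> of positive integers is given by the set \<open>U\<close> together with
  \<open>d :: nat \<Rightarrow> nat\<close>. All notions below use \<open>d\<close> only on \<open>U\<close>, so that the restriction of \<open>d\<close> to a
  subset \<open>V\<close> of \<open>U\<close> is represented by the pair \<open>V\<close>, \<open>d\<close>.
\<close>

text \<open>
  On a nonempty set of natural numbers, \<^const>\<open>Inf\<close> is the minimum. The set below is nonempty
  for every \<open>s\<close> as soon as \<open>1 \<in> U\<close>.
\<close>

definition initial_degree :: "nat set \<Rightarrow> (nat \<Rightarrow> nat) \<Rightarrow> nat \<Rightarrow> nat" where
  "initial_degree U d s = Inf {(\<Sum>i\<in>U. d i * b i) | b :: nat \<Rightarrow> nat. (\<Sum>i\<in>U. i * b i) = s}"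

definition subadditive_term :: "nat set \<Rightarrow> (nat \<Rightarrow> nat) \<Rightarrow> nat \<Rightarrow> bool" where
  "subadditive_term U d s \<longleftrightarrow>
     (\<forall>m\<ge>1. \<forall>a :: nat \<Rightarrow> nat.
        (\<forall>i\<in>{1..m}. a i \<in> U) \<and> (\<Sum>i=1..m. a i) = s \<longrightarrow> d s \<le> (\<Sum>i=1..m. d (a i)))"

definition strictly_subadditive_term :: "nat set \<Rightarrow> (nat \<Rightarrow> nat) \<Rightarrow> nat \<Rightarrow> bool" where
  "strictly_subadditive_term U d s \<longleftrightarrow>
     (\<forall>m\<ge>2. \<forall>a :: nat \<Rightarrow> nat.
        (\<forall>i\<in>{1..m}. a i \<in> U) \<and> (\<Sum>i=1..m. a i) = s \<longrightarrow> d s < (\<Sum>i=1..m. d (a i)))"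

definition strictly_subadditive_indices :: "nat set \<Rightarrow> (nat \<Rightarrow> nat) \<Rightarrow> nat set" where
  "strictly_subadditive_indices U d = {i \<in> U. strictly_subadditive_term U d i}"

text \<open>
  The convention that the term at \<open>1\<close> is both subadditive and strictly subadditive needs no
  separate clause: it holds automatically because all elements of \<open>U\<close> are positive.
\<close>

lemma sum_positive_ge_length:
  fixes a :: "nat \<Rightarrow> nat"
  assumes "0 \<notin> U" and "\<forall>i\<in>{1..m}. a i \<in> U"
  shows "m \<le> (\<Sum>i=1..m. a i)"
proof -
  have "1 \<le> a i" if "i \<in> {1..m}" for i
    using assms that by (metis One_nat_def Suc_leI neq0_conv)
  then have "(\<Sum>i=1..m. 1) \<le> (\<Sum>i=1..m. a i)"
    by (intro sum_mono)
  then show ?thesis by simp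
qed

lemma strictly_subadditive_term_1:
  assumes "0 \<notin> U"
  shows "strictly_subadditive_term U d 1"
  unfolding strictly_subadditive_term_def
  using sum_positive_ge_length[OF assms] by fastforce

lemma subadditive_term_1:
  assumes "0 \<notin> U"
  shows "subadditive_term U d 1"
  unfolding subadditive_term_def
proof (intro allI impI, elim conjE)
  fix m :: nat and a :: "nat \<Rightarrow> nat"
  assume m: "1 \<le> m" and a: "\<forall>i\<in>{1..m}. a i \<in> U" and s: "(\<Sum>i=1..m. a i) = 1"
  have "m = 1"
    using sum_positive_ge_length[OF assms a] m s by simp
  then show "d 1 \<le> (\<Sum>i=1..m. d (a i))"
    using s by simp
qed

end

theory Submission
  imports Defs
begin

text \<open>
  Sequences in \<open>U\<close> and families of multiplicities carry the same information, so both kinds of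
  subadditivity are statements about families \<open>b\<close>; this gives (a) and (b). Since \<open>\<alpha>\<close> is a
  subadditive sequence, replacing each term that is not strictly subadditive by a no more
  expensive decomposition into smaller indices gives (c) by strong induction on the index. For (d),
  let \<open>\<mu>\<close> be the minimal ratio, attained at \<open>k\<close>; writing \<open>s = q k + r\<close> with \<open>r < k\<close> gives
  \<open>\<mu> s \<le> \<alpha>\<^sub>s \<le> \<mu> s + k d\<^sub>1\<close>.
\<close>

section \<open>Sequences and multiplicities\<close>

text \<open>Group the positions \<open>j\<close> by the value \<open>a j\<close>; the summand is
  constant on each fibre.\<close>

lemma sum_sequence_eq_sum_multiplicity:
  fixes f :: "'a \<Rightarrow> nat"
  assumes "finite U" and "finite J" and "\<forall>j\<in>J. a j \<in> U"
  shows "(\<Sum>j\<in>J. f (a j)) = (\<Sum>i\<in>U. f i * card {j\<in>J. a j = i})"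
proof -
  have "(\<Sum>j\<in>J. f (a j)) = (\<Sum>i\<in>U. \<Sum>j\<in>{j\<in>J. a j = i}. f (a j))"
    using assms by (subst sum.group) auto
  also have "\<dots> = (\<Sum>i\<in>U. f i * card {j\<in>J. a j = i})"
    by (rule sum.cong) auto
  finally show ?thesis .
qed

text \<open>The quantifier over \<open>f\<close> stands inside the existential because length, index
  sum and cost are all read off from one and the same list. The list is built by prepending
  \<open>b x\<close> copies of each \<open>x\<close>.\<close>

lemma exists_list_with_multiplicities:
  fixes b :: "'a \<Rightarrow> nat"
  assumes "finite U"
  shows "\<exists>xs. set xs \<subseteq> U \<and> (\<forall>f :: 'a \<Rightarrow> nat. sum_list (map f xs) = (\<Sum>i\<in>U. f i * b i))"
  using assms
proof (induction U)
  case empty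
  then show ?case by auto
next
  case (insert x F)
  then obtain xs where "set xs \<subseteq> F"
    and "\<forall>f :: 'a \<Rightarrow> nat. sum_list (map f xs) = (\<Sum>i\<in>F. f i * b i)"
    by blast
  with insert.hyps show ?case
    by (intro exI[of _ "replicate (b x) x @ xs"])
      (auto simp: sum_list_replicate map_replicate)
qed

lemma exists_sequence_with_multiplicities:
  fixes b :: "'a \<Rightarrow> nat"
  assumes "finite U"
  shows "\<exists>a. (\<forall>j\<in>{1..sum b U}. a j \<in> U) \<and>
    (\<forall>f :: 'a \<Rightarrow> nat. (\<Sum>j=1..sum b U. f (a j)) = (\<Sum>i\<in>U. f i * b i))"
proof -
  obtain xs where xs: "set xs \<subseteq> U"
    and sums: "\<And>f :: 'a \<Rightarrow> nat. sum_list (map f xs) = (\<Sum>i\<in>U. f i * b i)"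
    using exists_list_with_multiplicities[OF assms] by blast
  \<comment> \<open>The constant function 1 counts the entries.\<close>
  have len: "length xs = sum b U"
    using sums[of "\<lambda>_. 1"] by (simp add: sum_list_triv)
  have "(\<Sum>j=1..sum b U. f (xs ! (j - 1))) = (\<Sum>i\<in>U. f i * b i)" for f :: "'a \<Rightarrow> nat"
  proof -
    have "(\<Sum>j=1..sum b U. f (xs ! (j - 1))) = (\<Sum>j<sum b U. f (xs ! j))"
      by (rule sum.reindex_bij_witness[of _ Suc "\<lambda>j. j - 1"]) auto
    also have "\<dots> = sum_list (map f xs)"
      by (simp add: sum_list_sum_nth len atLeast0LessThan)
    finally show ?thesis by (simp add: sums)
  qed
  moreover have "\<forall>j\<in>{1..sum b U}. xs ! (j - 1) \<in> U"
  proof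
    fix j assume "j \<in> {1..sum b U}"
    then have "j - 1 < length xs" by (auto simp: len)
    then show "xs ! (j - 1) \<in> U" using xs nth_mem by blast
  qed
  ultimately show ?thesis
    by (intro exI[of _ "\<lambda>j. xs ! (j - 1)"]) blast
qed

text \<open>Leaving \<open>n\<close> and \<open>P\<close> open lets one proof serve both notions:
  \<open>n = 1\<close> with \<le>, and \<open>n = 2\<close> with \<open><\<close>. The length of a
  sequence turns into the total multiplicity \<open>sum b U\<close>.\<close>

lemma all_sequences_iff_all_multiplicities:
  fixes d :: "nat \<Rightarrow> nat"
  assumes "finite U"
  shows "(\<forall>m\<ge>n. \<forall>a :: nat \<Rightarrow> nat.
      (\<forall>j\<in>{1..m}. a j \<in> U) \<and> (\<Sum>j=1..m. a j) = s \<longrightarrow> P (\<Sum>j=1..m. d (a j))) \<longleftrightarrow>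
    (\<forall>b. n \<le> sum b U \<and> (\<Sum>i\<in>U. i * b i) = s \<longrightarrow> P (\<Sum>i\<in>U. d i * b i))"
    (is "?L \<longleftrightarrow> ?R")
proof
  assume L: ?L
  show ?R
  proof (intro allI impI, elim conjE)
    fix b assume n: "n \<le> sum b U" and s: "(\<Sum>i\<in>U. i * b i) = s"
    obtain a where a: "\<forall>j\<in>{1..sum b U}. a j \<in> U"
      and sums: "\<And>f :: nat \<Rightarrow> nat. (\<Sum>j=1..sum b U. f (a j)) = (\<Sum>i\<in>U. f i * b i)"
      using exists_sequence_with_multiplicities[OF assms] by blast
    have "(\<Sum>j=1..sum b U. a j) = s"
      using sums[of "\<lambda>i. i"] s by simp
    with L n a have "P (\<Sum>j=1..sum b U. d (a j))" by blast
    then show "P (\<Sum>i\<in>U. d i * b i)" by (simp only: sums)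
  qed
next
  assume R: ?R
  show ?L
  proof (intro allI impI, elim conjE)
    fix m and a :: "nat \<Rightarrow> nat"
    assume m: "n \<le> m" and a: "\<forall>j\<in>{1..m}. a j \<in> U" and s: "(\<Sum>j=1..m. a j) = s"
    define b where "b i = card {j\<in>{1..m}. a j = i}" for i
    have sums: "(\<Sum>j=1..m. f (a j)) = (\<Sum>i\<in>U. f i * b i)" for f :: "nat \<Rightarrow> nat"
      unfolding b_def using assms a by (intro sum_sequence_eq_sum_multiplicity) auto
    have "sum b U = m" using sums[of "\<lambda>_. 1"] by simp
    moreover have "(\<Sum>i\<in>U. i * b i) = s" using sums[of "\<lambda>i. i"] s by simp
    ultimately have "P (\<Sum>i\<in>U. d i * b i)" using R m by blast
    then show "P (\<Sum>j=1..m. d (a j))" by (simp only: sums)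
  qed
qed

lemma subadditive_term_iff_multiplicities:
  assumes "finite U"
  shows "subadditive_term U d s \<longleftrightarrow>
    (\<forall>b. 1 \<le> sum b U \<and> (\<Sum>i\<in>U. i * b i) = s \<longrightarrow> d s \<le> (\<Sum>i\<in>U. d i * b i))"
  unfolding subadditive_term_def by (rule all_sequences_iff_all_multiplicities[OF assms])

lemma strictly_subadditive_term_iff_multiplicities:
  assumes "finite U"
  shows "strictly_subadditive_term U d s \<longleftrightarrow>
    (\<forall>b. 2 \<le> sum b U \<and> (\<Sum>i\<in>U. i * b i) = s \<longrightarrow> d s < (\<Sum>i\<in>U. d i * b i))"
  unfolding strictly_subadditive_term_def by (rule all_sequences_iff_all_multiplicities[OF assms])

text \<open>A single copy of \<open>s\<close> already uses up the whole weight \<open>s\<close>, so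
  \<open>b s > 0\<close> leaves room for nothing else. Conversely, a family without \<open>s\<close>
  cannot have total multiplicity 0, since \<open>s\<close> is positive, nor 1, since its only index
  would be \<open>s\<close>.\<close>

lemma two_le_sum_multiplicities_iff:
  fixes b :: "nat \<Rightarrow> nat"
  assumes "finite U" and pos: "\<forall>i\<in>U. 1 \<le> i" and "s \<in> U" and s: "(\<Sum>i\<in>U. i * b i) = s"
  shows "2 \<le> sum b U \<longleftrightarrow> b s = 0"
proof -
  have split_s: "s = s * b s + (\<Sum>i\<in>U - {s}. i * b i)" and split_b: "sum b U = b s + sum b (U - {s})"
    using s sum.remove[OF assms(1,3), of "\<lambda>i. i * b i"] sum.remove[OF assms(1,3), of b] by auto
  \<comment> \<open>As indices are positive, the weight left over by \<open>s\<close> bounds the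
    number of the other terms.\<close>
  have le: "sum b (U - {s}) \<le> (\<Sum>i\<in>U - {s}. i * b i)"
    using pos by (intro sum_mono) auto
  have "1 \<le> s" using pos assms(3) by auto
  show ?thesis
  proof
    assume "b s = 0"
    show "2 \<le> sum b U"
    proof (rule ccontr)
      assume "\<not> 2 \<le> sum b U"
      moreover have "sum b U \<noteq> 0"
        using \<open>1 \<le> s\<close> s assms(1) by (intro notI) simp
      ultimately have "sum b U = Suc 0" by linarith
      then obtain k where "k \<in> U" "b k = Suc 0" and zero: "\<forall>i\<in>U. k \<noteq> i \<longrightarrow> b i = 0"
        using sum_eq_Suc0_iff[OF assms(1)] by blast
      have "(\<Sum>i\<in>U. i * b i) = k * b k"
        using \<open>k \<in> U\<close> zero assms(1) by (subst sum.remove[of U k]) auto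
      with s \<open>b k = Suc 0\<close> \<open>b s = 0\<close> show False by auto
    qed
  next
    assume two: "2 \<le> sum b U"
    show "b s = 0"
    proof (rule ccontr)
      assume "b s \<noteq> 0"
      show False
      proof (cases "b s = 1")
        case True
        then show False using split_s split_b le two by simp
      next
        case False
        then have "s * 2 \<le> s * b s" using \<open>b s \<noteq> 0\<close> by (intro mult_le_mono2) simp
        then show False using split_s \<open>1 \<le> s\<close> by linarith
      qed
    qed
  qed
qed

lemma strictly_subadditive_term_iff:
  assumes "finite U" and "\<forall>i\<in>U. 1 \<le> i" and "s \<in> U"
  shows "strictly_subadditive_term U d s \<longleftrightarrow>
    (\<forall>b. (\<Sum>i\<in>U. i * b i) = s \<and> b s = 0 \<longrightarrow> d s < (\<Sum>i\<in>U. d i * b i))"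
  unfolding strictly_subadditive_term_iff_multiplicities[OF assms(1)]
  using two_le_sum_multiplicities_iff[OF assms] by blast

section \<open>The initial degree sequence\<close>

lemma initial_degree_le:
  assumes "(\<Sum>i\<in>U. i * b i) = s"
  shows "initial_degree U d s \<le> (\<Sum>i\<in>U. d i * b i)"
  unfolding initial_degree_def using assms by (intro cInf_lower) auto

lemma sum_mult_single:
  fixes f :: "'a \<Rightarrow> nat"
  assumes "finite U" and "k \<in> U"
  shows "(\<Sum>i\<in>U. f i * (if i = k then n else 0)) = f k * n"
  using assms by (subst sum.remove[of U k]) auto

lemma initial_degree_attained:
  assumes "finite U" and "1 \<in> U"
  obtains b where "(\<Sum>i\<in>U. i * b i) = s" and "initial_degree U d s = (\<Sum>i\<in>U. d i * b i)"
proof -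
  let ?S = "{(\<Sum>i\<in>U. d i * b i) | b :: nat \<Rightarrow> nat. (\<Sum>i\<in>U. i * b i) = s}"
  \<comment> \<open>The family of \<open>s\<close> copies of 1 shows that the minimum is over a
    nonempty set.\<close>
  have "(\<Sum>i\<in>U. i * (if i = 1 then s else 0)) = s"
    using sum_mult_single[OF assms, of "\<lambda>i. i" s] by simp
  then have "\<exists>b. (\<Sum>i\<in>U. i * b i) = s"
    by (rule exI[of _ "\<lambda>i. if i = 1 then s else 0"])
  then have "?S \<noteq> {}" by simp
  then have "initial_degree U d s \<in> ?S"
    unfolding initial_degree_def by (rule Inf_nat_def1)
  then show ?thesis by (auto intro: that)
qed

text \<open>One copy of \<open>s\<close> is an admissible family.\<close>

lemma initial_degree_le_term:
  assumes "finite U" and "s \<in> U"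
  shows "initial_degree U d s \<le> d s"
  using initial_degree_le[where d = d, OF sum_mult_single[OF assms, where f = "\<lambda>i. i" and n = 1]]
  by (simp only: sum_mult_single[OF assms] mult_1_right)

lemma initial_degree_0: "initial_degree U d 0 = 0"
  using initial_degree_le[where U = U and d = d and s = 0 and b = "\<lambda>_. 0"] by simp

lemma subadditive_term_iff_initial_degree:
  assumes "finite U" and "\<forall>i\<in>U. 1 \<le> i" and "1 \<in> U" and "s \<in> U"
  shows "subadditive_term U d s \<longleftrightarrow> initial_degree U d s = d s"
proof
  assume sub: "subadditive_term U d s"
  obtain b where b: "(\<Sum>i\<in>U. i * b i) = s" "initial_degree U d s = (\<Sum>i\<in>U. d i * b i)"
    using initial_degree_attained[OF assms(1,3)] .
  \<comment> \<open>Subadditivity speaks of at least one summand, so the empty family must be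
    excluded; its weight 0 is not \<open>s\<close>.\<close>
  have "sum b U \<noteq> 0"
    using b(1) assms(1,2,4) by (intro notI) auto
  then have "d s \<le> initial_degree U d s"
    using sub b unfolding subadditive_term_iff_multiplicities[OF assms(1)] by simp
  then show "initial_degree U d s = d s"
    using initial_degree_le_term[OF assms(1,4), of d] by simp
next
  assume "initial_degree U d s = d s"
  then show "subadditive_term U d s"
    unfolding subadditive_term_iff_multiplicities[OF assms(1)] by (metis initial_degree_le)
qed

text \<open>The pointwise sum of two optimal families is admissible for
  \<open>s + t\<close>.\<close>

lemma initial_degree_add_le:
  assumes "finite U" and "1 \<in> U"
  shows "initial_degree U d (s + t) \<le> initial_degree U d s + initial_degree U d t"
proof -
  obtain b where b: "(\<Sum>i\<in>U. i * b i) = s" "initial_degree U d s = (\<Sum>i\<in>U. d i * b i)"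
    using initial_degree_attained[OF assms] .
  obtain c where c: "(\<Sum>i\<in>U. i * c i) = t" "initial_degree U d t = (\<Sum>i\<in>U. d i * c i)"
    using initial_degree_attained[OF assms] .
  show ?thesis
    using initial_degree_le[where U = U and d = d and s = "s + t" and b = "\<lambda>i. b i + c i"] b c
    by (simp add: distrib_left sum.distrib)
qed

lemma initial_degree_mult_le:
  assumes "finite U" and "1 \<in> U"
  shows "initial_degree U d (s * n) \<le> initial_degree U d s * n"
proof (induction n)
  case 0
  then show ?case by (simp add: initial_degree_0)
next
  case (Suc n)
  then show ?case
    using initial_degree_add_le[OF assms, of d s "s * n"] by simp
qed

text \<open>The index set \<open>F\<close> is separate from \<open>U\<close> because later the
  degree is taken over the strictly subadditive indices while the sum runs over all indices.\<close>

lemma initial_degree_sum_le: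
  assumes "finite U" and "1 \<in> U" and "finite F"
  shows "initial_degree U d (\<Sum>i\<in>F. i * b i) \<le> (\<Sum>i\<in>F. initial_degree U d i * b i)"
  using assms(3)
proof (induction F)
  case empty
  then show ?case by (simp add: initial_degree_0)
next
  case (insert x F)
  have "initial_degree U d (x * b x + (\<Sum>i\<in>F. i * b i))
      \<le> initial_degree U d (x * b x) + initial_degree U d (\<Sum>i\<in>F. i * b i)"
    by (rule initial_degree_add_le[OF assms(1,2)])
  also have "\<dots> \<le> initial_degree U d x * b x + (\<Sum>i\<in>F. initial_degree U d i * b i)"
    using initial_degree_mult_le[OF assms(1,2)] insert.IH by (rule add_mono)
  finally show ?case using insert.hyps by simp
qed

text \<open>An optimal family on \<open>V\<close>, extended by zero, is admissible on
  \<open>U\<close>.\<close>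

lemma initial_degree_antimono:
  assumes "finite U" and "V \<subseteq> U" and "1 \<in> V"
  shows "initial_degree U d s \<le> initial_degree V d s"
proof -
  have "finite V" using assms finite_subset by blast
  then obtain b where b: "(\<Sum>i\<in>V. i * b i) = s" "initial_degree V d s = (\<Sum>i\<in>V. d i * b i)"
    using initial_degree_attained assms(3) by blast
  have ext: "(\<Sum>i\<in>U. f i * (if i \<in> V then b i else 0)) = (\<Sum>i\<in>V. f i * b i)" for f :: "nat \<Rightarrow> nat"
    using assms by (intro sum.mono_neutral_cong_right) auto
  show ?thesis
    using initial_degree_le[where U = U and d = d and s = s and b = "\<lambda>i. if i \<in> V then b i else 0"] b
    by (simp only: ext)
qed

section \<open>Reduction to the strictly subadditive terms\<close>

lemma initial_degree_strictly_subadditive_indices_le: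
  fixes d :: "nat \<Rightarrow> nat"
  assumes "finite U" and "\<forall>i\<in>U. 1 \<le> i" and "1 \<in> U" and "s \<in> U"
  shows "initial_degree (strictly_subadditive_indices U d) d s \<le> d s"
  using assms(4)
proof (induction s rule: less_induct)
  case (less s)
  let ?V = "strictly_subadditive_indices U d"
  have V: "finite ?V" "1 \<in> ?V"
    using assms strictly_subadditive_term_1[of U d]
    by (auto simp: strictly_subadditive_indices_def)
  show ?case
  proof (cases "strictly_subadditive_term U d s")
    case True
    then have "s \<in> ?V" using less.prems by (simp add: strictly_subadditive_indices_def)
    then show ?thesis using initial_degree_le_term V(1) by blast
  next
    case False
    then obtain b where b: "(\<Sum>i\<in>U. i * b i) = s" "b s = 0" "(\<Sum>i\<in>U. d i * b i) \<le> d s"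
      unfolding strictly_subadditive_term_iff[OF assms(1,2) less.prems] by (auto simp: not_less)
    \<comment> \<open>Every index that occurs is at most \<open>s\<close> by weight, and differs
      from \<open>s\<close> because \<open>b s = 0\<close>, so the induction hypothesis covers it.
      For absent indices both sides vanish.\<close>
    have "initial_degree ?V d i * b i \<le> d i * b i" if "i \<in> U" for i
    proof (cases "b i = 0")
      case False
      have "i * b i \<le> s"
        using member_le_sum[of i U "\<lambda>i. i * b i"] that assms(1) b(1) by simp
      moreover have "i \<le> i * b i" using False by simp
      ultimately have "i \<le> s" by linarith
      with False b(2) have "i < s" by (cases "i = s") auto
      then show ?thesis using less.IH that by simp
    qed simp
    then have "(\<Sum>i\<in>U. initial_degree ?V d i * b i) \<le> (\<Sum>i\<in>U. d i * b i)"
      by (rule sum_mono)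
    then show ?thesis
      using initial_degree_sum_le[OF V assms(1), of d b] b by simp
  qed
qed

lemma initial_degree_strictly_subadditive_indices:
  fixes d :: "nat \<Rightarrow> nat"
  assumes "finite U" and "\<forall>i\<in>U. 1 \<le> i" and "1 \<in> U"
  shows "initial_degree (strictly_subadditive_indices U d) d s = initial_degree U d s"
proof (rule antisym)
  let ?V = "strictly_subadditive_indices U d"
  have V: "finite ?V" "1 \<in> ?V" "?V \<subseteq> U"
    using assms strictly_subadditive_term_1[of U d]
    by (auto simp: strictly_subadditive_indices_def)
  obtain b where b: "(\<Sum>i\<in>U. i * b i) = s" "initial_degree U d s = (\<Sum>i\<in>U. d i * b i)"
    using initial_degree_attained[OF assms(1,3)] .
  \<comment> \<open>Each index of an optimal family over \<open>U\<close> is replaced by an optimal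
    family over \<open>?V\<close>, at no greater cost by the preceding lemma.\<close>
  have "initial_degree ?V d s \<le> (\<Sum>i\<in>U. initial_degree ?V d i * b i)"
    using initial_degree_sum_le[OF V(1,2) assms(1), of d b] b by simp
  also have "\<dots> \<le> (\<Sum>i\<in>U. d i * b i)"
    by (intro sum_mono mult_le_mono1 initial_degree_strictly_subadditive_indices_le assms)
  finally show "initial_degree ?V d s \<le> initial_degree U d s" using b by simp
  show "initial_degree U d s \<le> initial_degree ?V d s"
    using initial_degree_antimono[OF assms(1) V(3,2)] .
qed

section \<open>Asymptotics\<close>

text \<open>The bound on each index is summed over an optimal family.\<close>

lemma initial_degree_ge_ratio:
  assumes "finite U" and "1 \<in> U" and ratio: "\<And>i. i \<in> U \<Longrightarrow> \<mu> * real i \<le> real (d i)"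
  shows "\<mu> * real s \<le> real (initial_degree U d s)"
proof -
  obtain b where b: "(\<Sum>i\<in>U. i * b i) = s" "initial_degree U d s = (\<Sum>i\<in>U. d i * b i)"
    using initial_degree_attained[OF assms(1,2)] .
  have "\<mu> * real s = (\<Sum>i\<in>U. \<mu> * real i * real (b i))"
    by (simp flip: b(1) add: sum_distrib_left mult.assoc)
  also have "\<dots> \<le> (\<Sum>i\<in>U. real (d i) * real (b i))"
    by (intro sum_mono mult_right_mono ratio) auto
  finally show ?thesis by (simp add: b(2))
qed

text \<open>Use as many copies of \<open>k\<close> as fit and fill the remainder with copies of 1.
  The remainder is below \<open>k\<close>, so the error term does not depend on \<open>s\<close> and
  disappears after division by \<open>s\<close>.\<close>

lemma initial_degree_le_ratio:
  assumes "finite U" and "1 \<in> U" and "k \<in> U" and "1 \<le> k"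
  shows "real (initial_degree U d s) \<le> real (d k) / real k * real s + real (d 1 * k)"
proof -
  have mult: "initial_degree U d (i * n) \<le> d i * n" if "i \<in> U" for i n
    using initial_degree_mult_le[OF assms(1,2), of d i n] initial_degree_le_term[OF assms(1) that]
    by (meson le_trans mult_le_mono1)
  \<comment> \<open>The factor \<open>1 *\<close> makes the remainder a multiple of the index 1, so
    that \<open>mult\<close> applies to both parts.\<close>
  have "initial_degree U d s \<le> initial_degree U d (k * (s div k)) + initial_degree U d (1 * (s mod k))"
    using initial_degree_add_le[OF assms(1,2), of d "k * (s div k)" "s mod k"] by simp
  also have "\<dots> \<le> d k * (s div k) + d 1 * (s mod k)"
    using mult[OF assms(3)] mult[OF assms(2)] by (rule add_mono)
  also have "\<dots> \<le> d k * (s div k) + d 1 * k"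
    using assms(4) by (simp add: less_imp_le)
  finally have "real (initial_degree U d s) \<le> real (d k) * real (s div k) + real (d 1 * k)"
    by (metis of_nat_add of_nat_mono of_nat_mult)
  also have "real (d k) * real (s div k) \<le> real (d k) * (real s / real k)"
    by (intro mult_left_mono of_nat_div_le_of_nat) simp
  finally show ?thesis by simp
qed

lemma initial_degree_over_index_tendsto:
  assumes "finite U" and pos: "\<forall>i\<in>U. 1 \<le> i" and "1 \<in> U"
  shows "(\<lambda>s. real (initial_degree U d s) / real s)
    \<longlonglongrightarrow> Min ((\<lambda>i. real (d i) / real i) ` U)"
proof -
  define \<mu> where "\<mu> = Min ((\<lambda>i. real (d i) / real i) ` U)"
  have "\<mu> \<in> (\<lambda>i. real (d i) / real i) ` U"
    unfolding \<mu>_def using assms by (intro Min_in) auto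
  then obtain k where k: "k \<in> U" "\<mu> = real (d k) / real k" by auto
  have ratio: "\<mu> * real i \<le> real (d i)" if "i \<in> U" for i
  proof -
    have "\<mu> \<le> real (d i) / real i" unfolding \<mu>_def using that assms by (intro Min_le) auto
    moreover have "0 < real i" using pos that by fastforce
    ultimately show ?thesis by (simp add: field_simps)
  qed
  \<comment> \<open>Both bounds are claimed only eventually, for \<open>s > 0\<close>, where
    division by \<open>s\<close> is meaningful.\<close>
  have lower: "\<forall>\<^sub>F s in sequentially. \<mu> \<le> real (initial_degree U d s) / real s"
    using eventually_gt_at_top[of 0]
  proof eventually_elim
    case (elim s)
    then show ?case
      using initial_degree_ge_ratio[of U \<mu> d s, OF assms(1,3) ratio] by (simp add: field_simps)
  qed
  have upper: "\<forall>\<^sub>F s in sequentially.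
      real (initial_degree U d s) / real s \<le> \<mu> + real (d 1 * k) / real s"
    using eventually_gt_at_top[of 0]
  proof eventually_elim
    case (elim s)
    have "real (initial_degree U d s) \<le> \<mu> * real s + real (d 1 * k)"
      using initial_degree_le_ratio[OF assms(1,3) k(1)] pos k by blast
    then have "real (initial_degree U d s) / real s \<le> (\<mu> * real s + real (d 1 * k)) / real s"
      by (rule divide_right_mono) simp
    then show ?case using elim by (simp add: add_divide_distrib)
  qed
  have "(\<lambda>s. \<mu> + real (d 1 * k) / real s) \<longlonglongrightarrow> \<mu> + 0"
    by (intro tendsto_add tendsto_const lim_const_over_n)
  then have "(\<lambda>s. real (initial_degree U d s) / real s) \<longlonglongrightarrow> \<mu>"
    using tendsto_sandwich[OF lower upper tendsto_const] by simp
  then show ?thesis by (simp only: \<mu>_def)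
qed

theorem proposition4p5:
  fixes U :: "nat set" and d :: "nat \<Rightarrow> nat"
  assumes "finite U" and "\<forall>i\<in>U. 1 \<le> i" and "1 \<in> U" and "\<forall>i\<in>U. 1 \<le> d i"
  shows "(\<forall>s\<in>U. subadditive_term U d s \<longleftrightarrow> initial_degree U d s = d s) \<and>
    (\<forall>s\<in>U. strictly_subadditive_term U d s \<longleftrightarrow>
       (\<forall>b :: nat \<Rightarrow> nat. (\<Sum>i\<in>U. i * b i) = s \<and> b s = 0 \<longrightarrow> d s < (\<Sum>i\<in>U. b i * d i))) \<and>
    (\<forall>s\<ge>1. initial_degree U d s = initial_degree (strictly_subadditive_indices U d) d s) \<and>
    (\<lambda>s. real (initial_degree U d s) / real s) \<longlonglongrightarrow>
       Min ((\<lambda>i. real (d i) / real i) ` strictly_subadditive_indices U d)"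
proof -
  let ?V = "strictly_subadditive_indices U d"
  have V: "finite ?V" "\<forall>i\<in>?V. 1 \<le> i" "1 \<in> ?V"
    using assms strictly_subadditive_term_1[of U d]
    by (auto simp: strictly_subadditive_indices_def)
  have c: "initial_degree ?V d s = initial_degree U d s" for s
    by (rule initial_degree_strictly_subadditive_indices[OF assms(1-3)])
  \<comment> \<open>The limit is computed with \<open>?V\<close> as the ground set, which puts the
    minimum over \<open>?V\<close>; \<open>c\<close> then turns the degrees over \<open>?V\<close>
    into those over \<open>U\<close>.\<close>
  have "(\<lambda>s. real (initial_degree U d s) / real s) \<longlonglongrightarrow>
      Min ((\<lambda>i. real (d i) / real i) ` ?V)"
    using initial_degree_over_index_tendsto[OF V, of d] by (simp only: c)
  then show ?thesis
    using subadditive_term_iff_initial_degree[OF assms(1-3)]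
      strictly_subadditive_term_iff[OF assms(1,2)]
    by (simp add: c mult.commute[of "d _"])
qed

end
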